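(* Let $q$ be a prime power, $n\ge1$, and let $L(x)=\sum_{i=0}^{n-1}a_ix^{q^i}\in\mathscr{L}_n(\mathbb{F}_{q^n})$ be a linearized permutation polynomial with associated Dickson matrix $D_L$. For $0\le i\le n-1$ let $\bar a_i$ be the $(i,0)$-th cofactor of $D_L$. Then $\det L=\sum_{i=0}^{n-1}a_{n-i}^{q^i}\bar a_i$ (subscripts reduced modulo $n$) and \[L^{-1}(x)=\frac{1}{\det L}\sum_{i=0}^{n-1}\bar a_ix^{q^i}=\Big(\sum_{i=0}^{n-1}\bar a_ix^{q^i}\Big)\circ\Big(\frac{x}{\det L}\Big).\]
   Context: $\mathscr{L}_n(\mathbb{F}_{q^n})$ is the set of linearized polynomials $\sum_{i=0}^{n-1}a_ix^{q^i}\in\mathbb{F}_{q^n}[x]/(x^{q^n}-x)$, $a_i\in\mathbb{F}_{q^n}$, with composition $\circ$ as multiplication. Such $L$ is a linearized permutation polynomial if it induces a bijection of $\mathbb{F}_{q^n}$; $L^{-1}(x)$ denotes the inverse of $L(x)$ under composition in $\mathscr{L}_n(\mathbb{F}_{q^n})$. $\det L\in\mathbb{F}_q$ is the determinant of the $\mathbb{F}_q$-linear transformation of $\mathbb{F}_{q^n}$ induced by $L$. The Dickson matrix associated to $L$ is $D_L=\left(a_{j-i}^{q^i}\right)_{0\le i,j\le n-1}$ (the $(i,j)$ entry is $a_{j-i}^{q^i}$, subscripts reduced modulo $n$). Rows and columns are indexed from $0$, and the $(i,j)$-th cofactor is $(-1)^{i+j}$ times the minor obtained by deleting row $i$ and column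 $j$. *)

theory Defs
  imports
    "HOL-Number_Theory.Prime_Powers"
    "HOL-Algebra.Group"
    "Jordan_Normal_Form.Determinant"
begin

text \<open>
  Throughout, the type \<open>'a\<close> is the field with \<open>q^n\<close> elements; its subfield with \<open>q\<close>
  elements consists of the fixed points of the \<open>q\<close>-power map.
\<close>

definition Fq :: "nat \<Rightarrow> 'a::field set" where
  "Fq q = {c. c ^ q = c}"

text \<open>
  Classes modulo \<open>x^(q^n) - x\<close> are represented by their remainders. The elements of
  \<open>linearized_monoid q n\<close> are such remainders, as all exponents \<open>q^i\<close> with \<open>i < n\<close> are
  smaller than \<open>q^n\<close>.
\<close>

definition linearized_poly :: "nat \<Rightarrow> nat \<Rightarrow> (nat \<Rightarrow> 'a::field) \<Rightarrow> 'a poly" where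
  "linearized_poly q n a = (\<Sum>i<n. Polynomial.monom (a i) (q ^ i))"

definition linearized_monoid :: "nat \<Rightarrow> nat \<Rightarrow> 'a::field poly monoid" where
  "linearized_monoid q n =
    \<lparr>carrier = range (linearized_poly q n),
     mult = (\<lambda>f g. (f \<circ>\<^sub>p g) mod (Polynomial.monom 1 (q ^ n) - Polynomial.monom 1 1)),
     one = Polynomial.monom 1 1\<rparr>"

definition Fq_basis :: "nat \<Rightarrow> nat \<Rightarrow> (nat \<Rightarrow> 'a::field) \<Rightarrow> bool" where
  "Fq_basis q n b \<longleftrightarrow>
    (\<forall>x. \<exists>!c. c \<in> carrier_vec n \<and> (\<forall>i<n. c $ i \<in> Fq q) \<and> x = (\<Sum>i<n. c $ i * b i))"

definition represents :: "nat \<Rightarrow> nat \<Rightarrow> (nat \<Rightarrow> 'a::field) \<Rightarrow> 'a mat \<Rightarrow> ('a \<Rightarrow> 'a) \<Rightarrow> bool" where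
  "represents q n b M f \<longleftrightarrow>
    M \<in> carrier_mat n n \<and> (\<forall>i<n. \<forall>j<n. M $$ (i, j) \<in> Fq q) \<and>
    (\<forall>j<n. f (b j) = (\<Sum>i<n. M $$ (i, j) * b i))"

text \<open>
  The determinant of an \<open>Fq\<close>-linear map does not depend on the basis, which makes the
  following description definite.
\<close>

definition Fq_det :: "nat \<Rightarrow> nat \<Rightarrow> ('a::field \<Rightarrow> 'a) \<Rightarrow> 'a" where
  "Fq_det q n f = (THE d. \<exists>b M. Fq_basis q n b \<and> represents q n b M f \<and> d = det M)"

text \<open>For \<open>i < n\<close> the index \<open>(n + j - i) mod n\<close> is \<open>j - i\<close> reduced modulo \<open>n\<close>.\<close>

definition dickson_mat :: "nat \<Rightarrow> nat \<Rightarrow> (nat \<Rightarrow> 'a::field) \<Rightarrow> 'a mat" where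
  "dickson_mat q n a = mat n n (\<lambda>(i, j). a ((n + j - i) mod n) ^ (q ^ i))"

end

theory Submission
  imports Defs "HOL-Number_Theory.Residues"
begin

text \<open>
  Let \<open>D\<close> be the Dickson matrix of \<open>L\<close>. Since the \<open>q\<close>-power map is a ring endomorphism and
  \<open>x^(q^n) = x\<close> on the field, the values \<open>L(x)^(q^i)\<close> are the entries of \<open>D\<close> applied to the
  vector of the powers \<open>x^(q^k)\<close> (\<open>dickson_row\<close>). Everything follows from this identity and from
  the fact that a linearized polynomial, having degree below \<open>q^n\<close>, is determined by its values.

  Combining the rows of \<open>D\<close> with the cofactors of column 0, that is, multiplying by the first
  row of the adjugate, turns the identity into \<open>(\<Sum>i<n. abar i * L(x)^(q^i)) = det D * x\<close>
  (\<open>cofactor_poly_of_linearized\<close>). So \<open>\<Sum>i<n. abar i * x^(q^i)\<close> inverts \<open>L\<close> as a function up to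
  the scalar \<open>det D\<close>, and by comparison of values it does so in the monoid of linearized
  polynomials. The scalar is nonzero: a dependency between the rows of \<open>D\<close> would be a nonzero
  linearized polynomial vanishing on the image of \<open>L\<close> (\<open>det_dickson_nonzero\<close>).

  That \<open>det D\<close> is the determinant of the \<open>Fq\<close>-linear map \<open>L\<close> is seen by a change of basis. For a
  basis \<open>b\<close> in which \<open>L\<close> has the matrix \<open>M\<close>, let \<open>W\<close> be the Moore matrix with entries
  \<open>b j ^ (q^i)\<close>. Both \<open>D * W\<close> and \<open>W * M\<close> have the entries \<open>L(b j)^(q^i)\<close>, and \<open>W\<close> is invertible
  because a dependency between its rows would be a nonzero linearized polynomial vanishing on
  the basis; hence \<open>det M = det D\<close> (\<open>det_represents\<close>). A basis exists because \<open>Fq\<close> has exactly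
  \<open>q\<close> elements (\<open>card_Fq\<close>, \<open>Fq_basis_exists\<close>). The formula for the determinant is then the
  expansion of \<open>det D\<close> along column 0, and as \<open>det M\<close> lies in \<open>Fq\<close>, the scalar may be moved
  inside the linearized polynomial.
\<close>

section \<open>The Frobenius map\<close>

text \<open>
  Multiplication by \<open>x \<noteq> 0\<close> permutes the nonzero elements, so it does not change their product.
\<close>

lemma power_card_field:
  fixes x :: "'a::{field,finite}"
  shows "x ^ card (UNIV :: 'a set) = x"
proof (cases "x = 0")
  case False
  let ?U = "UNIV - {0 :: 'a}"
  have "bij_betw ((*) x) ?U ?U"
    by (rule bij_betwI[of _ _ _ "\<lambda>y. y / x"]) (use False in auto)
  then have "(\<Prod>y\<in>?U. x * y) = \<Prod>?U"
    by (rule prod.reindex_bij_betw)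
  then have "x ^ card ?U * \<Prod>?U = 1 * \<Prod>?U"
    by (simp add: prod.distrib)
  then have "x ^ card ?U = 1"
    by (subst (asm) mult_right_cancel) auto
  moreover have "card (UNIV :: 'a set) = Suc (card ?U)"
    by (rule card.remove) auto
  ultimately show ?thesis
    by (simp only: power_Suc mult_1_right)
qed (simp add: finite_UNIV_card_ge_0)

text \<open>
  The parameter \<open>field_type\<close> carries no data; it makes the type of the field a parameter of the
  locale.
\<close>
locale field_of_order =
  fixes q n :: nat and field_type :: "'a::{field,finite} itself"
  assumes primepow_q: "primepow q" and n_pos: "n \<ge> 1"
    and card_field: "card (UNIV :: 'a set) = q ^ n"
begin

lemma q_gt_1: "q > 1"
  using primepow_gt_Suc_0[OF primepow_q] by simp

lemma power_q_n [simp]: "x ^ (q ^ n) = (x :: 'a)"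
  using power_card_field[of x] card_field by simp

lemma power_q_mod: "x ^ (q ^ (k mod n)) = (x :: 'a) ^ (q ^ k)"
proof -
  have "x ^ (q ^ (k mod n + n * m)) = x ^ (q ^ (k mod n))" for m
  proof (induction m)
    case (Suc m)
    have "q ^ (k mod n + n * Suc m) = q ^ (k mod n + n * m) * q ^ n"
      by (simp add: power_add)
    with Suc show ?case by (simp only: power_mult power_q_n)
  qed simp
  from this[of "k div n"] show ?thesis
    by simp
qed

lemma prime_CHAR: "prime CHAR('a)"
  by (intro prime_CHAR_semidom finite_imp_CHAR_pos) simp

lemma q_eq_CHAR_power: "\<exists>k. q = CHAR('a) ^ k"
proof -
  obtain p k where p: "prime p" "q = p ^ k"
    using primepow_q by (auto simp: primepow_def)
  have "CHAR('a) dvd p ^ (k * n)"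
    using CHAR_dvd_CARD[where ?'a = 'a] by (simp add: card_field p power_mult)
  then have "CHAR('a) dvd p"
    by (rule prime_dvd_power[OF prime_CHAR])
  then have "CHAR('a) = p"
    by (rule primes_dvd_imp_eq[OF prime_CHAR p(1)])
  with p(2) show ?thesis by auto
qed

lemma power_q_add: "(x + y) ^ (q ^ i) = (x :: 'a) ^ (q ^ i) + y ^ (q ^ i)"
proof -
  obtain k where "q = CHAR('a) ^ k" using q_eq_CHAR_power ..
  then show ?thesis
    by (intro freshmans_dream'[OF prime_CHAR, of _ "k * i"]) (simp add: power_mult)
qed

lemma power_q_sum: "(\<Sum>x\<in>A. f x) ^ (q ^ i) = (\<Sum>x\<in>A. (f x :: 'a) ^ (q ^ i))"
proof -
  obtain k where "q = CHAR('a) ^ k" using q_eq_CHAR_power ..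
  then show ?thesis
    by (intro freshmans_dream_sum'[OF prime_CHAR, of _ "k * i"]) (simp add: power_mult)
qed

lemma Frobenius_hom: "comm_ring_hom (\<lambda>x :: 'a. x ^ q)"
  by unfold_locales (use q_gt_1 power_q_add[of _ _ 1] in \<open>auto simp: power_mult_distrib\<close>)

interpretation Frobenius: comm_ring_hom "\<lambda>x :: 'a. x ^ q"
  by (rule Frobenius_hom)

section \<open>The subfield with q elements\<close>

lemma Fq_diff: "x \<in> Fq q \<Longrightarrow> y \<in> Fq q \<Longrightarrow> x - y \<in> (Fq q :: 'a set)"
  by (simp add: Fq_def Frobenius.hom_minus)

lemma Fq_divide: "x \<in> Fq q \<Longrightarrow> y \<in> Fq q \<Longrightarrow> x / y \<in> (Fq q :: 'a set)"
  by (simp add: Fq_def power_divide)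

lemma Fq_power: "(c :: 'a) \<in> Fq q \<Longrightarrow> c ^ (q ^ i) = c"
  by (induction i) (simp_all add: Fq_def power_mult)

lemma det_in_Fq:
  assumes "\<And>i j. i < n \<Longrightarrow> j < n \<Longrightarrow> M $$ (i, j) \<in> Fq q" and M: "M \<in> carrier_mat n n"
  shows "det M \<in> (Fq q :: 'a set)"
proof -
  have "map_mat (\<lambda>x. x ^ q) M = M"
    using assms by (intro eq_matI) (auto simp: Fq_def)
  then show ?thesis
    using Frobenius.hom_det[of M] by (simp add: Fq_def)
qed

section \<open>Linearized polynomials as functions\<close>

lemma poly_linearized: "poly (linearized_poly q n c) x = (\<Sum>i<n. c i * (x :: 'a) ^ (q ^ i))"
  by (simp add: linearized_poly_def poly_sum poly_monom)

lemma degree_linearized: "degree (linearized_poly q n c :: 'a poly) \<le> q ^ (n - 1)"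
  unfolding linearized_poly_def
proof (rule degree_sum_le)
  fix i assume "i \<in> {..<n}"
  then have "q ^ i \<le> q ^ (n - 1)"
    using q_gt_1 by (intro power_increasing) auto
  with degree_monom_le[of "c i" "q ^ i"] show "degree (Polynomial.monom (c i) (q ^ i)) \<le> q ^ (n - 1)"
    by (rule order_trans)
qed simp

lemma degree_linearized_less: "degree (linearized_poly q n c :: 'a poly) < q ^ n"
proof -
  have "q ^ (n - 1) < q ^ n"
    using q_gt_1 n_pos by (intro power_strict_increasing) auto
  with degree_linearized show ?thesis by (rule le_less_trans)
qed

lemma coeff_linearized:
  assumes "i < n"
  shows "poly.coeff (linearized_poly q n c) (q ^ i) = (c i :: 'a)"
proof -
  have "poly.coeff (linearized_poly q n c) (q ^ i) = (\<Sum>j<n. if j = i then c j else 0)"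
    unfolding linearized_poly_def coeff_sum using q_gt_1
    by (intro sum.cong) (auto simp: power_inject_exp)
  then show ?thesis using assms by simp
qed

text \<open>
  A polynomial of degree below \<open>q^n\<close> has fewer roots than the field has elements unless it
  is zero, so remainders modulo \<open>x^(q^n) - x\<close> can be compared through their values.
\<close>
lemma poly_eqI_values:
  fixes f g :: "'a poly"
  assumes "degree f < q ^ n" "degree g < q ^ n" "\<And>x. poly f x = poly g x"
  shows "f = g"
  using assms by (intro poly_eqI_degree[of UNIV]) (auto simp: card_field)

lemma linearized_coeffs_zero:
  assumes "\<And>x :: 'a. (\<Sum>i<n. c i * x ^ (q ^ i)) = 0" and "i < n"
  shows "c i = 0"
proof -
  have "linearized_poly q n c = 0"
    by (rule poly_eqI_values) (use assms(1) degree_linearized_less q_gt_1 in \<open>auto simp: poly_linearized\<close>)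
  with coeff_linearized[OF assms(2), of c] show ?thesis by simp
qed

lemma linearized_Fq_linear:
  fixes b :: "'i \<Rightarrow> 'a"
  assumes "\<And>j. j \<in> A \<Longrightarrow> c j \<in> Fq q"
  shows "poly (linearized_poly q n a) (\<Sum>j\<in>A. c j * b j) =
    (\<Sum>j\<in>A. c j * poly (linearized_poly q n a) (b j))"
proof -
  have "poly (linearized_poly q n a) (\<Sum>j\<in>A. c j * b j) =
      (\<Sum>i<n. \<Sum>j\<in>A. a i * (c j * b j ^ (q ^ i)))"
    using assms
    by (simp add: poly_linearized power_q_sum power_mult_distrib Fq_power sum_distrib_left)
  also have "\<dots> = (\<Sum>j\<in>A. \<Sum>i<n. a i * (c j * b j ^ (q ^ i)))"
    by (rule sum.swap)
  finally show ?thesis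
    by (simp add: poly_linearized sum_distrib_left mult_ac)
qed

section \<open>Bases over the subfield\<close>

text \<open>
  The polynomial \<open>x^q - x\<close> gives the upper bound. For the lower bound, the additive map
  \<open>x \<mapsto> x^q - x\<close> has kernel \<open>Fq\<close>, and by telescoping its image consists of roots of the trace
  polynomial \<open>\<Sum>i<n. y^(q^i)\<close>, of which there are at most \<open>q^(n-1)\<close>; so the \<open>q^n\<close> elements of
  the field are spread over at most \<open>q^(n-1)\<close> fibres, each no larger than \<open>Fq\<close>.
\<close>
lemma card_Fq: "card (Fq q :: 'a set) = q"
proof (rule antisym)
  let ?p = "Polynomial.monom 1 q - Polynomial.monom 1 1 :: 'a poly"
  have "poly.coeff ?p q = 1"
    using q_gt_1 by simp
  then have "?p \<noteq> 0" by (metis coeff_0 zero_neq_one)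
  have "Fq q = {x. poly ?p x = 0}"
    by (auto simp: Fq_def poly_monom)
  also have "card \<dots> \<le> degree ?p"
    by (rule card_poly_roots_bound) fact
  also have "\<dots> \<le> q"
    using q_gt_1 by (intro degree_diff_le) (auto intro: order_trans[OF degree_monom_le])
  finally show "card (Fq q :: 'a set) \<le> q" .
next
  let ?g = "\<lambda>x :: 'a. x ^ q - x"
  let ?T = "linearized_poly q n (\<lambda>_. 1) :: 'a poly"
  have power_q_diff: "(x - y :: 'a) ^ (q ^ i) = x ^ (q ^ i) - y ^ (q ^ i)" for x y i
    using power_q_add[of "x - y" y i] by simp
  have "poly ?T (?g x) = 0" for x
  proof -
    have "poly ?T (?g x) = (\<Sum>i<n. x ^ (q ^ Suc i) - x ^ (q ^ i))"
      by (simp add: poly_linearized power_q_diff flip: power_mult)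
    also have "\<dots> = 0"
      by (subst sum_lessThan_telescope) simp
    finally show ?thesis .
  qed
  moreover have "?T \<noteq> 0"
    using coeff_linearized[of 0 "\<lambda>_. 1"] n_pos by auto
  ultimately have "card (range ?g) \<le> degree ?T"
    by (intro order_trans[OF card_mono card_poly_roots_bound]) auto
  then have image: "card (range ?g) \<le> q ^ (n - 1)"
    using degree_linearized order_trans by blast
  have fibre: "card (?g -` {y}) \<le> card (Fq q :: 'a set)" if "y \<in> range ?g" for y
  proof -
    from that obtain x0 where "?g x0 = y" by auto
    then have "(\<lambda>x. x - x0) ` (?g -` {y}) \<subseteq> Fq q"
      by (auto simp: Fq_def Frobenius.hom_minus algebra_simps)
    then show ?thesis
      by (intro card_inj_on_le[of "\<lambda>x. x - x0"]) (auto simp: inj_on_def)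
  qed
  have "(\<Union>y\<in>range ?g. ?g -` {y}) = UNIV"
    by auto
  then have "q ^ n = card (\<Union>y\<in>range ?g. ?g -` {y})"
    by (simp only: card_field)
  also have "\<dots> \<le> (\<Sum>y\<in>range ?g. card (?g -` {y}))"
    by (rule card_UN_le) simp
  also have "\<dots> \<le> (\<Sum>y\<in>range ?g. card (Fq q :: 'a set))"
    by (rule sum_mono) (rule fibre)
  also have "\<dots> \<le> q ^ (n - 1) * card (Fq q :: 'a set)"
    using image by simp
  also have "q ^ n = q ^ (n - 1) * q"
    using n_pos by (simp add: power_eq_if)
  finally show "q \<le> card (Fq q :: 'a set)"
    using q_gt_1 by simp
qed

text \<open>
  Independent families are grown one element at a time: the span of \<open>m < n\<close> elements has at
  most \<open>q^m\<close> elements, so something lies outside it.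
\<close>
lemma independent_family_exists:
  "m \<le> n \<Longrightarrow> \<exists>b :: nat \<Rightarrow> 'a. inj_on (\<lambda>c. \<Sum>i<m. c i * b i) ({..<m} \<rightarrow>\<^sub>E Fq q)"
proof (induction m)
  case 0
  then show ?case by (simp add: inj_on_def)
next
  case (Suc m)
  then obtain b :: "nat \<Rightarrow> 'a" where
    b: "inj_on (\<lambda>c. \<Sum>i<m. c i * b i) ({..<m} \<rightarrow>\<^sub>E Fq q)" by auto
  let ?S = "(\<lambda>c. \<Sum>i<m. c i * b i) ` ({..<m} \<rightarrow>\<^sub>E Fq q)"
  have "card ?S = q ^ m"
    by (simp add: card_image[OF b] card_PiE card_Fq)
  also have "\<dots> < card (UNIV :: 'a set)"
    unfolding card_field using Suc.prems q_gt_1 by (intro power_strict_increasing) auto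
  finally obtain x where x: "x \<notin> ?S" by (metis UNIV_eq_I less_irrefl)
  let ?b = "b(m := x)"
  have "inj_on (\<lambda>c. \<Sum>i<Suc m. c i * ?b i) ({..<Suc m} \<rightarrow>\<^sub>E Fq q)"
  proof (rule inj_onI)
    fix c d assume c: "c \<in> {..<Suc m} \<rightarrow>\<^sub>E Fq q" and d: "d \<in> {..<Suc m} \<rightarrow>\<^sub>E Fq q"
      and eq0: "(\<Sum>i<Suc m. c i * ?b i) = (\<Sum>i<Suc m. d i * ?b i)"
    then have eq: "(\<Sum>i<m. c i * b i) + c m * x = (\<Sum>i<m. d i * b i) + d m * x"
      by simp
    have mem: "c i \<in> Fq q" "d i \<in> Fq q" if "i \<le> m" for i
      using c d that by (auto simp: PiE_iff)
    have cm: "c m = d m"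
    proof (rule ccontr)
      assume ne: "c m \<noteq> d m"
      \<comment> \<open>Solving the equation for \<open>x\<close> would express it by these coefficients.\<close>
      let ?e = "restrict (\<lambda>i. (d i - c i) / (c m - d m)) {..<m}"
      have "(\<Sum>i<m. ?e i * b i) = (\<Sum>i<m. (d i * b i - c i * b i) / (c m - d m))"
        by (intro sum.cong) (auto simp: algebra_simps)
      also have "\<dots> = ((\<Sum>i<m. d i * b i) - (\<Sum>i<m. c i * b i)) / (c m - d m)"
        by (simp add: sum_subtractf flip: sum_divide_distrib)
      also have "\<dots> = x"
        using eq ne by (simp add: field_simps)
      finally have "x = (\<Sum>i<m. ?e i * b i)" by simp
      moreover have "?e \<in> {..<m} \<rightarrow>\<^sub>E Fq q"
        using mem by (auto intro!: Fq_divide Fq_diff)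
      ultimately have "x \<in> ?S" by (rule image_eqI)
      with x show False ..
    qed
    have "restrict c {..<m} = restrict d {..<m}"
      by (rule inj_onD[OF b]) (use eq cm mem in auto)
    with cm have "c i = d i" if "i < Suc m" for i
      using that by (cases "i = m") (auto simp: less_Suc_eq dest!: fun_cong[where x = i])
    then show "c = d"
      by (intro PiE_ext[OF c d]) auto
  qed
  then show ?case by (rule exI[of _ ?b])
qed

lemma Fq_basis_exists: "\<exists>b :: nat \<Rightarrow> 'a. Fq_basis q n b"
proof -
  obtain b :: "nat \<Rightarrow> 'a" where inj: "inj_on (\<lambda>c. \<Sum>i<n. c i * b i) ({..<n} \<rightarrow>\<^sub>E Fq q)"
    using independent_family_exists[of n] by auto
  have "card ((\<lambda>c. \<Sum>i<n. c i * b i) ` ({..<n} \<rightarrow>\<^sub>E Fq q)) = card (UNIV :: 'a set)"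
    by (simp add: card_image[OF inj] card_PiE card_Fq card_field)
  then have surj: "(\<lambda>c. \<Sum>i<n. c i * b i) ` ({..<n} \<rightarrow>\<^sub>E Fq q) = UNIV"
    by (intro card_subset_eq) auto
  have "\<exists>!c. c \<in> carrier_vec n \<and> (\<forall>i<n. c $ i \<in> Fq q) \<and> x = (\<Sum>i<n. c $ i * b i)" for x
  proof (rule ex_ex1I)
    have "x \<in> (\<lambda>c. \<Sum>i<n. c i * b i) ` ({..<n} \<rightarrow>\<^sub>E Fq q)"
      using surj by simp
    then obtain c where "c \<in> {..<n} \<rightarrow>\<^sub>E Fq q" "x = (\<Sum>i<n. c i * b i)"
      by blast
    then show "\<exists>c. c \<in> carrier_vec n \<and> (\<forall>i<n. c $ i \<in> Fq q) \<and> x = (\<Sum>i<n. c $ i * b i)"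
      by (intro exI[of _ "vec n c"]) auto
  next
    fix c d :: "'a vec"
    assume c: "c \<in> carrier_vec n \<and> (\<forall>i<n. c $ i \<in> Fq q) \<and> x = (\<Sum>i<n. c $ i * b i)"
      and d: "d \<in> carrier_vec n \<and> (\<forall>i<n. d $ i \<in> Fq q) \<and> x = (\<Sum>i<n. d $ i * b i)"
    have "restrict (($) c) {..<n} = restrict (($) d) {..<n}"
      by (rule inj_onD[OF inj]) (use c d in auto)
    then have "c $ i = d $ i" if "i < n" for i
      using that by (auto dest!: fun_cong[where x = i])
    with c d show "c = d" by (intro eq_vecI) auto
  qed
  then show ?thesis unfolding Fq_basis_def by blast
qed

section \<open>The Dickson matrix and the determinant\<close>

text \<open>
  Raising \<open>L(x) = \<Sum>m. a m * x^(q^m)\<close> to the power \<open>q^i\<close> shifts the exponents cyclically, as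
  \<open>x^(q^n) = x\<close>; the coefficients that result form the \<open>i\<close>-th row of the Dickson matrix.
\<close>
lemma dickson_row:
  assumes "i < n"
  shows "(\<Sum>k<n. dickson_mat q n a $$ (i, k) * x ^ (q ^ k)) =
    poly (linearized_poly q n a) (x :: 'a) ^ (q ^ i)"
proof -
  have "poly (linearized_poly q n a) x ^ (q ^ i) = (\<Sum>m<n. a m ^ (q ^ i) * x ^ (q ^ (m + i)))"
    by (simp add: poly_linearized power_q_sum power_mult_distrib power_add flip: power_mult)
  also have "\<dots> = (\<Sum>k<n. a ((n + k - i) mod n) ^ (q ^ i) * x ^ (q ^ k))"
  proof (rule sum.reindex_bij_witness[of _ "\<lambda>k. (n + k - i) mod n" "\<lambda>m. (m + i) mod n"])
    fix m assume m: "m \<in> {..<n}"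
    show inv: "(n + (m + i) mod n - i) mod n = m"
      using m assms by (cases "m + i < n") (auto simp: le_mod_geq)
    show "a ((n + (m + i) mod n - i) mod n) ^ (q ^ i) * x ^ (q ^ ((m + i) mod n)) =
        a m ^ (q ^ i) * x ^ (q ^ (m + i))"
      by (simp only: inv power_q_mod)
  next
    fix k assume "k \<in> {..<n}"
    then show "((n + k - i) mod n + i) mod n = k"
      using assms by (cases "k < i") (auto simp: le_mod_geq)
  qed (use assms in auto)
  finally show ?thesis
    using assms by (simp add: dickson_mat_def)
qed

definition moore_mat :: "(nat \<Rightarrow> 'a) \<Rightarrow> 'a mat" where
  "moore_mat b = mat n n (\<lambda>(i, j). b j ^ (q ^ i))"

lemma dickson_mult_moore:
  "dickson_mat q n a * moore_mat b = moore_mat (\<lambda>j. poly (linearized_poly q n a) (b j))"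
proof (rule eq_matI)
  fix i j assume "i < dim_row (moore_mat (\<lambda>j. poly (linearized_poly q n a) (b j)))"
    "j < dim_col (moore_mat (\<lambda>j. poly (linearized_poly q n a) (b j)))"
  then have ij: "i < n" "j < n" by (auto simp: moore_mat_def)
  then have "(dickson_mat q n a * moore_mat b) $$ (i, j) =
      (\<Sum>k<n. dickson_mat q n a $$ (i, k) * b j ^ (q ^ k))"
    by (simp add: scalar_prod_def moore_mat_def dickson_mat_def lessThan_atLeast0)
  with ij show "(dickson_mat q n a * moore_mat b) $$ (i, j) =
      moore_mat (\<lambda>j. poly (linearized_poly q n a) (b j)) $$ (i, j)"
    by (simp add: dickson_row) (simp add: moore_mat_def)
qed (auto simp: moore_mat_def dickson_mat_def)

lemma moore_mult_represents:
  assumes "represents q n b M f"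
  shows "moore_mat b * M = moore_mat (\<lambda>j. f (b j))"
proof (rule eq_matI)
  have M: "M \<in> carrier_mat n n" and Fq: "\<And>i j. i < n \<Longrightarrow> j < n \<Longrightarrow> M $$ (i, j) \<in> Fq q"
    and f: "\<And>j. j < n \<Longrightarrow> f (b j) = (\<Sum>i<n. M $$ (i, j) * b i)"
    using assms by (auto simp: represents_def)
  {
    fix i j assume "i < dim_row (moore_mat (\<lambda>j. f (b j)))" "j < dim_col (moore_mat (\<lambda>j. f (b j)))"
    then have ij: "i < n" "j < n" by (auto simp: moore_mat_def)
    then have "(moore_mat b * M) $$ (i, j) = (\<Sum>k<n. b k ^ (q ^ i) * M $$ (k, j))"
      using M by (simp add: scalar_prod_def moore_mat_def lessThan_atLeast0)
    also have "\<dots> = (\<Sum>k<n. (M $$ (k, j) * b k) ^ (q ^ i))"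
      using ij Fq by (intro sum.cong) (simp_all add: power_mult_distrib Fq_power)
    also have "\<dots> = f (b j) ^ (q ^ i)"
      using ij by (simp add: f power_q_sum)
    finally show "(moore_mat b * M) $$ (i, j) = moore_mat (\<lambda>j. f (b j)) $$ (i, j)"
      using ij by (simp add: moore_mat_def)
  }
qed (use assms in \<open>auto simp: moore_mat_def represents_def\<close>)

lemma row_dependency:
  assumes A: "(A :: 'a mat) \<in> carrier_mat n n" and "det A = 0"
  obtains v where "\<forall>j<n. (\<Sum>i<n. v i * A $$ (i, j)) = 0" "\<exists>i<n. v i \<noteq> 0"
proof -
  have "det (transpose_mat A) = 0"
    using assms det_transpose[OF A] by simp
  then obtain v where v: "v \<in> carrier_vec n" "v \<noteq> 0\<^sub>v n" "transpose_mat A *\<^sub>v v = 0\<^sub>v n"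
    using det_0_iff_vec_prod_zero[of "transpose_mat A" n] A by auto
  have "\<forall>j<n. (\<Sum>i<n. v $ i * A $$ (i, j)) = 0"
  proof (intro allI impI)
    fix j assume j: "j < n"
    have "(transpose_mat A *\<^sub>v v) $ j = (\<Sum>i<n. A $$ (i, j) * v $ i)"
      using A v(1) j by (simp add: scalar_prod_def lessThan_atLeast0)
    then show "(\<Sum>i<n. v $ i * A $$ (i, j)) = 0"
      using v(3) j by (simp add: mult.commute)
  qed
  moreover have "\<exists>i<n. v $ i \<noteq> 0"
    using v by (metis eq_vecI carrier_vecD index_zero_vec)
  ultimately show thesis by (rule that)
qed

text \<open>
  A dependency between the rows is a linearized polynomial that vanishes on the basis,
  hence by linearity on the whole field.
\<close>
lemma det_moore_nonzero:
  assumes "Fq_basis q n b"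
  shows "det (moore_mat b) \<noteq> 0"
proof
  assume det: "det (moore_mat b) = 0"
  have W: "moore_mat b \<in> carrier_mat n n" by (simp add: moore_mat_def)
  obtain v where v: "\<forall>j<n. (\<Sum>i<n. v i * moore_mat b $$ (i, j)) = 0"
    and nz: "\<exists>i<n. v i \<noteq> 0"
    by (rule row_dependency[OF W det])
  have zero: "poly (linearized_poly q n v) (b j) = 0" if "j < n" for j
    using v that by (simp add: moore_mat_def poly_linearized)
  have "poly (linearized_poly q n v) x = 0" for x
  proof -
    obtain c where c: "\<forall>i<n. c $ i \<in> Fq q" "x = (\<Sum>i<n. c $ i * b i)"
      using assms unfolding Fq_basis_def by metis
    then have "poly (linearized_poly q n v) x =
        (\<Sum>i<n. c $ i * poly (linearized_poly q n v) (b i))"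
      using linearized_Fq_linear[of "{..<n}" "($) c" v b] by auto
    then show ?thesis using zero by simp
  qed
  then have "v i = 0" if "i < n" for i
    using that by (intro linearized_coeffs_zero[of v i]) (simp_all add: poly_linearized)
  with nz show False by blast
qed

text \<open>
  The Moore matrix of the basis conjugates the representing matrix into the Dickson matrix.
\<close>
lemma det_represents:
  assumes "Fq_basis q n b" "represents q n b M (poly (linearized_poly q n a))"
  shows "det M = det (dickson_mat q n a :: 'a mat)"
proof -
  let ?W = "moore_mat b" and ?D = "dickson_mat q n a"
  have "?W * M = ?D * ?W"
    by (simp add: moore_mult_represents[OF assms(2)] dickson_mult_moore)
  moreover have "?W \<in> carrier_mat n n" "?D \<in> carrier_mat n n" "M \<in> carrier_mat n n"
    using assms(2) by (auto simp: moore_mat_def dickson_mat_def represents_def)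
  ultimately have "det ?W * det M = det ?D * det ?W"
    by (metis det_mult)
  with det_moore_nonzero[OF assms(1)] show ?thesis by simp
qed

lemma represents_exists:
  assumes "Fq_basis q n b"
  shows "\<exists>M. represents q n b M f"
proof -
  have "\<forall>x. \<exists>c. (\<forall>i<n. c $ i \<in> Fq q) \<and> x = (\<Sum>i<n. c $ i * b i)"
    using assms unfolding Fq_basis_def by blast
  from choice[OF this] obtain c
    where "\<forall>x. (\<forall>i<n. c x $ i \<in> Fq q) \<and> x = (\<Sum>i<n. c x $ i * b i)" ..
  then have c: "\<And>x i. i < n \<Longrightarrow> c x $ i \<in> Fq q"
    and sum_c: "\<And>x. (\<Sum>i<n. c x $ i * b i) = x"
    by auto
  have "represents q n b (mat n n (\<lambda>(i, j). c (f (b j)) $ i)) f"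
    unfolding represents_def using c by (simp add: sum_c)
  then show ?thesis ..
qed

lemma Fq_det_eq_det_dickson:
  "Fq_det q n (poly (linearized_poly q n a)) = det (dickson_mat q n a :: 'a mat)"
  unfolding Fq_det_def
proof (rule the_equality)
  show "\<exists>b M. Fq_basis q n b \<and> represents q n b M (poly (linearized_poly q n a)) \<and>
      det (dickson_mat q n a) = det M"
    using Fq_basis_exists represents_exists det_represents by metis
qed (use det_represents in auto)

lemma det_dickson_in_Fq: "det (dickson_mat q n a) \<in> (Fq q :: 'a set)"
proof -
  obtain b :: "nat \<Rightarrow> 'a" where b: "Fq_basis q n b"
    using Fq_basis_exists ..
  obtain M where M: "represents q n b M (poly (linearized_poly q n a))"
    using represents_exists[OF b] ..
  then have "det M \<in> Fq q"
    by (intro det_in_Fq) (auto simp: represents_def)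
  with det_represents[OF b M] show ?thesis by simp
qed

text \<open>
  If the rows were dependent with coefficients \<open>v\<close>, then \<open>\<Sum>i. v i * y^(q^i)\<close> would vanish
  at all values \<open>y = L(x)\<close>, which are all field elements.
\<close>
lemma det_dickson_nonzero:
  assumes "surj (poly (linearized_poly q n a) :: 'a \<Rightarrow> 'a)"
  shows "det (dickson_mat q n a) \<noteq> 0"
proof
  let ?D = "dickson_mat q n a"
  assume det: "det ?D = 0"
  have D: "?D \<in> carrier_mat n n" by (simp add: dickson_mat_def)
  obtain v where v: "\<forall>j<n. (\<Sum>i<n. v i * ?D $$ (i, j)) = 0"
    and nz: "\<exists>i<n. v i \<noteq> 0"
    by (rule row_dependency[OF D det])
  have "(\<Sum>i<n. v i * y ^ (q ^ i)) = 0" for y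
  proof -
    obtain x where x: "y = poly (linearized_poly q n a) x"
      using assms by auto
    have "(\<Sum>i<n. v i * y ^ (q ^ i)) = (\<Sum>i<n. v i * (\<Sum>k<n. ?D $$ (i, k) * x ^ (q ^ k)))"
      by (simp add: x dickson_row)
    also have "\<dots> = (\<Sum>i<n. \<Sum>k<n. v i * ?D $$ (i, k) * x ^ (q ^ k))"
      by (simp add: sum_distrib_left mult_ac)
    also have "\<dots> = (\<Sum>k<n. (\<Sum>i<n. v i * ?D $$ (i, k)) * x ^ (q ^ k))"
      by (subst sum.swap) (simp add: sum_distrib_right)
    also have "\<dots> = 0" using v by simp
    finally show ?thesis .
  qed
  then have "v i = 0" if "i < n" for i
    using that by (intro linearized_coeffs_zero[of v i]) simp_all
  with nz show False by blast
qed

section \<open>The inverse\<close>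

text \<open>
  The cofactors of column 0 combine the rows of the Dickson matrix to \<open>det D\<close> times the first
  unit vector, hence the powers \<open>L(x)^(q^i)\<close> to \<open>det D * x\<close>.
\<close>
lemma cofactor_poly_of_linearized:
  defines "D \<equiv> (\<lambda>a. dickson_mat q n a :: 'a mat)"
  shows "poly (linearized_poly q n (\<lambda>i. cofactor (D a) i 0)) (poly (linearized_poly q n a) x) =
    det (D a) * x"
proof -
  let ?c = "\<lambda>i. cofactor (D a) i 0"
  have D: "D a \<in> carrier_mat n n" by (simp add: D_def dickson_mat_def)
  have adj: "(\<Sum>i<n. ?c i * D a $$ (i, k)) = (if k = 0 then det (D a) else 0)" if "k < n" for k
  proof -
    have "(\<Sum>i<n. ?c i * D a $$ (i, k)) = (adj_mat (D a) * D a) $$ (0, k)"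
      using D that n_pos by (simp add: scalar_prod_def adj_mat_def lessThan_atLeast0)
    also have "\<dots> = (if k = 0 then det (D a) else 0)"
      using that n_pos by (simp add: adj_mat(3)[OF D])
    finally show ?thesis .
  qed
  have "poly (linearized_poly q n ?c) (poly (linearized_poly q n a) x) =
      (\<Sum>i<n. ?c i * (\<Sum>k<n. D a $$ (i, k) * x ^ (q ^ k)))"
    by (subst poly_linearized[of ?c]) (simp add: D_def dickson_row)
  also have "\<dots> = (\<Sum>i<n. \<Sum>k<n. ?c i * D a $$ (i, k) * x ^ (q ^ k))"
    by (simp add: sum_distrib_left mult_ac)
  also have "\<dots> = (\<Sum>k<n. (\<Sum>i<n. ?c i * D a $$ (i, k)) * x ^ (q ^ k))"
    by (subst sum.swap) (simp add: sum_distrib_right)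
  also have "\<dots> = (\<Sum>k<n. if k = 0 then det (D a) * x else 0)"
    by (intro sum.cong) (auto simp: adj)
  also have "\<dots> = det (D a) * x" using n_pos by simp
  finally show ?thesis .
qed

lemma poly_linearized_mult:
  "poly (f \<otimes>\<^bsub>linearized_monoid q n\<^esub> g) x = poly f (poly g (x :: 'a))"
proof -
  let ?m = "Polynomial.monom 1 (q ^ n) - Polynomial.monom 1 1 :: 'a poly"
  have zero: "poly ?m x = 0" by (simp add: poly_monom)
  have "poly (p mod ?m) x = poly p x" for p
  proof -
    have "poly p x = poly (p div ?m * ?m + p mod ?m) x"
      by (simp only: div_mult_mod_eq)
    with zero show ?thesis
      by (simp only: poly_add poly_mult mult_zero_right add_0_left)
  qed
  then show ?thesis by (simp add: linearized_monoid_def poly_pcompose)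
qed

lemma degree_linearized_mult: "degree (f \<otimes>\<^bsub>linearized_monoid q n\<^esub> g :: 'a poly) < q ^ n"
proof -
  let ?m = "Polynomial.monom 1 (q ^ n) - Polynomial.monom 1 1 :: 'a poly"
  have "q ^ n > 1" using q_gt_1 n_pos by (intro one_less_power) auto
  then have "degree ?m = q ^ n"
    unfolding diff_conv_add_uminus by (subst degree_add_eq_left) (simp_all add: degree_monom_eq)
  moreover from this have "?m \<noteq> 0" using \<open>q ^ n > 1\<close> by (metis degree_0 not_one_less_zero)
  ultimately show ?thesis
    using degree_mod_less[of ?m "f \<circ>\<^sub>p g"] \<open>q ^ n > 1\<close> q_gt_1
    by (auto simp: linearized_monoid_def)
qed

text \<open>
  Since elements of the monoid are determined by their values and multiply as functions, the
  inverse of a permutation can be recognised by evaluation on one side.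
\<close>
lemma linearized_inv_eqI:
  assumes bij: "bij (poly (linearized_poly q n a) :: 'a \<Rightarrow> 'a)"
    and left: "\<And>x. poly (linearized_poly q n g) (poly (linearized_poly q n a) x) = (x :: 'a)"
  shows "inv\<^bsub>linearized_monoid q n\<^esub> (linearized_poly q n a) = linearized_poly q n g"
proof -
  let ?G = "linearized_monoid q n :: 'a poly monoid" and ?L = "linearized_poly q n a"
  have right: "poly ?L (poly (linearized_poly q n g) y) = y" for y
    using left bij by (metis bij_pointE)
  have one: "degree \<one>\<^bsub>?G\<^esub> < q ^ n" "poly \<one>\<^bsub>?G\<^esub> x = x" for x
    using one_less_power[OF q_gt_1, of n] n_pos
    by (simp_all add: linearized_monoid_def degree_monom_eq poly_monom)
  show ?thesis
    unfolding m_inv_def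
  proof (rule the_equality)
    show "linearized_poly q n g \<in> carrier ?G \<and>
        ?L \<otimes>\<^bsub>?G\<^esub> linearized_poly q n g = \<one>\<^bsub>?G\<^esub> \<and>
        linearized_poly q n g \<otimes>\<^bsub>?G\<^esub> ?L = \<one>\<^bsub>?G\<^esub>"
      by (intro conjI poly_eqI_values degree_linearized_mult one)
        (auto simp: poly_linearized_mult one left right, simp add: linearized_monoid_def)
  next
    fix y assume y: "y \<in> carrier ?G \<and> ?L \<otimes>\<^bsub>?G\<^esub> y = \<one>\<^bsub>?G\<^esub> \<and> y \<otimes>\<^bsub>?G\<^esub> ?L = \<one>\<^bsub>?G\<^esub>"
    then have "degree y < q ^ n"
      using degree_linearized_less by (auto simp: linearized_monoid_def)
    moreover have "poly y x = poly (linearized_poly q n g) x" for x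
      using y left[of "poly y x"] by (metis poly_linearized_mult one(2))
    ultimately show "y = linearized_poly q n g"
      by (intro poly_eqI_values degree_linearized_less)
  qed
qed

lemma smult_linearized:
  "smult c (linearized_poly q n g) = linearized_poly q n (\<lambda>i. c * g i :: 'a)"
proof (rule poly_eqI_values)
  show "degree (smult c (linearized_poly q n g)) < q ^ n"
    by (rule le_less_trans[OF degree_smult_le degree_linearized_less])
qed (simp_all add: degree_linearized_less poly_linearized sum_distrib_left mult.assoc)

text \<open>
  The powers \<open>c^(q^i)\<close> that arise when \<open>c * x\<close> is substituted are all equal to \<open>c\<close>.
\<close>
lemma linearized_mult_scalar:
  assumes "c \<in> Fq q"
  shows "linearized_poly q n g \<otimes>\<^bsub>linearized_monoid q n\<^esub> Polynomial.monom c 1 =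
    smult c (linearized_poly q n g :: 'a poly)"
  unfolding smult_linearized
proof (rule poly_eqI_values)
  show "poly (linearized_poly q n g \<otimes>\<^bsub>linearized_monoid q n\<^esub> Polynomial.monom c 1) x =
      poly (linearized_poly q n (\<lambda>i. c * g i)) x" for x
    unfolding poly_linearized_mult poly_linearized using assms
    by (simp add: poly_monom power_mult_distrib Fq_power mult_ac)
qed (rule degree_linearized_mult degree_linearized_less)+

end

theorem theorem4p5:
  fixes q n :: nat and a :: "nat \<Rightarrow> 'a::{field,finite}"
  defines "L \<equiv> linearized_poly q n a"
  defines "abar \<equiv> (\<lambda>i. cofactor (dickson_mat q n a) i 0)"
  defines "detL \<equiv> Fq_det q n (poly L)"
  assumes "primepow q" and "n \<ge> 1" and "card (UNIV :: 'a set) = q ^ n"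
    and "bij (poly L)"
  shows "detL = (\<Sum>i<n. a ((n - i) mod n) ^ (q ^ i) * abar i) \<and>
    inv\<^bsub>linearized_monoid q n\<^esub> L = smult (1 / detL) (linearized_poly q n abar) \<and>
    inv\<^bsub>linearized_monoid q n\<^esub> L =
      linearized_poly q n abar \<otimes>\<^bsub>linearized_monoid q n\<^esub> Polynomial.monom (1 / detL) 1"
proof -
  interpret field_of_order q n "TYPE('a)"
    by (rule field_of_order.intro[OF assms(4-6)])
  let ?D = "dickson_mat q n a"
  have D: "?D \<in> carrier_mat n n" by (simp add: dickson_mat_def)
  have detL: "detL = det ?D"
    unfolding detL_def L_def by (rule Fq_det_eq_det_dickson)
  then have nz: "detL \<noteq> 0"
    using assms(7) det_dickson_nonzero by (auto simp: L_def bij_def)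
  have "detL = (\<Sum>i<n. ?D $$ (i, 0) * cofactor ?D i 0)"
    unfolding detL by (rule laplace_expansion_column[OF D]) (use n_pos in simp)
  also have "\<dots> = (\<Sum>i<n. a ((n - i) mod n) ^ (q ^ i) * abar i)"
    unfolding abar_def by (intro sum.cong) (simp_all add: dickson_mat_def)
  finally have "detL = (\<Sum>i<n. a ((n - i) mod n) ^ (q ^ i) * abar i)" .
  moreover have "inv\<^bsub>linearized_monoid q n\<^esub> L = smult (1 / detL) (linearized_poly q n abar)"
  proof -
    have "poly (smult (1 / detL) (linearized_poly q n abar)) (poly (linearized_poly q n a) x) = x"
      for x
      using nz by (simp add: abar_def cofactor_poly_of_linearized detL)
    then show ?thesis
      using assms(7) unfolding L_def smult_linearized by (intro linearized_inv_eqI)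
  qed
  moreover have "linearized_poly q n abar \<otimes>\<^bsub>linearized_monoid q n\<^esub> Polynomial.monom (1 / detL) 1 =
      smult (1 / detL) (linearized_poly q n abar)"
    using det_dickson_in_Fq[of a] unfolding detL
    by (intro linearized_mult_scalar) (simp add: Fq_def power_divide)
  ultimately show ?thesis by simp
qed

end
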